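(* Let $K$ be a positive, nontrivial semiring with a total zero-min order, and suppose $K$ contains a non-zero element $k$ with $k+k=k$. Then the axiomatization $\mathcal A_{IND}$ is sound and complete for the implication problem for (weighted) inclusion dependencies over $K$: for every finite set of variables $D$ and every finite set $\Sigma\cup\{\tau\}$ of atoms $\bar x\le\bar y$ over $D$, $\Sigma\vdash_{\mathcal A_{IND}}\tau$ iff $\Sigma\models_K\tau$.
   Context: Semirings $(K,+,\times,0,1)$: $(K,+,0)$ commutative monoid, $(K,\times,1)$ monoid, two-sided distributivity, $0\times a=a\times0=0$; positive ($a+b=0\Rightarrow a=b=0$; $a\times b=0\Rightarrow a=0$ or $b=0$). A total zero-min order is a total order $\le$ on $K$ with $a\le b\Rightarrow a+c\le b+c$; ($a\le b$, $0\le c$) $\Rightarrow a\times c\le b\times c$ and $c\times a\le c\times b$; and $a\le0\Rightarrow a=0$. $K$-teams: $D$ finite set of variables, $A$ finite set of values, $X$ finite set of assignments $s:D\to A$, $\mathbb X:X\to K$. For a tuple of variables $\bar x$ and $\bar a\in A^{|\bar x|}$, $|\mathbb X_{\bar x=\bar a}|=\sum_{s\in X,\,s(\bar x)=\bar a}\mathbb X(s)$ (empty sum $0$). For repetition-free tuples $\bar x,\bar y$ of the same length (no variable repeated within a tuple), $\mathbb X\models\bar x\le\bar y$ iff $|\mathbb X_{\bar x=\bar a}|\le|\mathbb X_{\bar y=\bar a}|$ for all $\bar a\in A^{|\bar x|}$. $\Sigma\models_K\tau$: every $K$-team over $D$ satisfying all of $\Sigma$ satisfies $\tau$. Deduction: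 $\Sigma\vdash_{\mathcal A}\sigma$ iff there is a sequence $\tau_1,\dots,\tau_n=\sigma$ with each $\tau_i\in\Sigma$ or $\tau_i\in\Gamma$ for an instance $\Lambda\vdash\Gamma$ of an axiom of $\mathcal A$ with $\Lambda\subseteq\Sigma\cup\{\tau_1,\dots,\tau_{i-1}\}$. $\mathcal A_{IND}$: IND1 $\emptyset\vdash\bar x\le\bar x$; IND2 $\{\bar x\le\bar y,\bar y\le\bar z\}\vdash\bar x\le\bar z$; IND3 $\bar x\le\bar y\vdash\rho(\bar x)\le\rho(\bar y)$ for every selection $\rho$, where for $\bar x=(x_1,\dots,x_n)$, $\bar y=(y_1,\dots,y_n)$ and a sequence $i_1,\dots,i_k$ ($1\le k\le n$) of distinct indices from $\{1,\dots,n\}$, $\rho(\bar x)=(x_{i_1},\dots,x_{i_k})$ and $\rho(\bar y)=(y_{i_1},\dots,y_{i_k})$. *)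

theory Defs
  imports "HOL-Library.FuncSet" "HOL-Library.Infinite_Typeclass"
begin

text \<open>Tuples of variables and of values are lists; tuple positions are counted from 0.\<close>

datatype 'v inc = Inc "'v list" "'v list"

fun atom_over :: "'v set \<Rightarrow> 'v inc \<Rightarrow> bool" where
  "atom_over D (Inc xs ys) \<longleftrightarrow>
     length xs = length ys \<and> distinct xs \<and> distinct ys \<and> set xs \<subseteq> D \<and> set ys \<subseteq> D"

text \<open>
  A team over \<open>D\<close> consists of a finite set \<open>A\<close> of values, a finite set \<open>X\<close> of assignments
  \<open>D \<rightarrow> A\<close> (extensional functions, so that distinct elements of \<open>X\<close> differ on \<open>D\<close>) and a
  weight function \<open>W\<close>, of which only the values on \<open>X\<close> are ever used.
\<close>

definition team :: "'v set \<Rightarrow> 'a set \<Rightarrow> ('v \<Rightarrow> 'a) set \<Rightarrow> bool" where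
  "team D A X \<longleftrightarrow> finite A \<and> finite X \<and> X \<subseteq> (D \<rightarrow>\<^sub>E A)"

definition weight ::
    "('v \<Rightarrow> 'a) set \<Rightarrow> (('v \<Rightarrow> 'a) \<Rightarrow> 'k::comm_monoid_add) \<Rightarrow> 'v list \<Rightarrow> 'a list \<Rightarrow> 'k" where
  "weight X W xs as = (\<Sum>s | s \<in> X \<and> map s xs = as. W s)"

fun satisfies ::
    "'a set \<Rightarrow> ('v \<Rightarrow> 'a) set \<Rightarrow> (('v \<Rightarrow> 'a) \<Rightarrow> 'k::{comm_monoid_add,ord}) \<Rightarrow> 'v inc \<Rightarrow> bool" where
  "satisfies A X W (Inc xs ys) \<longleftrightarrow>
     (\<forall>as. set as \<subseteq> A \<and> length as = length xs \<longrightarrow> weight X W xs as \<le> weight X W ys as)"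

text \<open>
  The type arguments are the weights \<open>'k\<close> and the universe \<open>'a\<close> from which the finite value sets
  are drawn. For an infinite \<open>'a\<close> this covers, up to renaming of values, all teams over \<open>D\<close>.
\<close>

definition entails ::
    "'k::{comm_monoid_add,ord} itself \<Rightarrow> 'a itself \<Rightarrow> 'v set \<Rightarrow> 'v inc set \<Rightarrow> 'v inc \<Rightarrow> bool" where
  "entails _ _ D \<Sigma> \<tau> \<longleftrightarrow>
     (\<forall>(A :: 'a set) X (W :: ('v \<Rightarrow> 'a) \<Rightarrow> 'k).
        team D A X \<and> (\<forall>\<sigma>\<in>\<Sigma>. satisfies A X W \<sigma>) \<longrightarrow> satisfies A X W \<tau>)"

text \<open>\<open>A_IND D \<Lambda> \<Gamma>\<close>: \<open>\<Lambda> \<turnstile> \<Gamma>\<close> is an axiom instance consisting of atoms over \<open>D\<close>.\<close>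

inductive A_IND :: "'v set \<Rightarrow> 'v inc set \<Rightarrow> 'v inc set \<Rightarrow> bool" for D where
  IND1: "atom_over D (Inc xs xs) \<Longrightarrow> A_IND D {} {Inc xs xs}"
| IND2: "atom_over D (Inc xs ys) \<Longrightarrow> atom_over D (Inc ys zs) \<Longrightarrow>
    A_IND D {Inc xs ys, Inc ys zs} {Inc xs zs}"
| IND3: "atom_over D (Inc xs ys) \<Longrightarrow> is \<noteq> [] \<Longrightarrow> distinct is \<Longrightarrow> set is \<subseteq> {..<length xs} \<Longrightarrow>
    A_IND D {Inc xs ys} {Inc (map ((!) xs) is) (map ((!) ys) is)}"

definition derivable ::
    "('v inc set \<Rightarrow> 'v inc set \<Rightarrow> bool) \<Rightarrow> 'v inc set \<Rightarrow> 'v inc \<Rightarrow> bool" where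
  "derivable \<A> \<Sigma> \<sigma> \<longleftrightarrow>
     (\<exists>\<tau>s. \<tau>s \<noteq> [] \<and> last \<tau>s = \<sigma> \<and>
       (\<forall>i<length \<tau>s. \<tau>s ! i \<in> \<Sigma> \<or>
          (\<exists>\<Lambda> \<Gamma>. \<A> \<Lambda> \<Gamma> \<and> \<tau>s ! i \<in> \<Gamma> \<and> \<Lambda> \<subseteq> \<Sigma> \<union> set (take i \<tau>s))))"

definition positive_semiring :: "'k::semiring_0 itself \<Rightarrow> bool" where
  "positive_semiring _ \<longleftrightarrow>
     (\<forall>a b :: 'k. a + b = 0 \<longrightarrow> a = 0 \<and> b = 0) \<and>
     (\<forall>a b :: 'k. a * b = 0 \<longrightarrow> a = 0 \<or> b = 0)"

text \<open>
  The class \<open>semiring_1\<close> includes \<open>0 \<noteq> 1\<close>, i.e. nontriviality. The classes \<open>ordered_semiring\<close> and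
  \<open>linorder\<close> provide a total order with monotone addition and with multiplication on either side
  by elements \<open>\<ge> 0\<close> monotone; what remains of a total zero-min order is the following.
\<close>

definition zero_min :: "'k::{zero,ord} itself \<Rightarrow> bool" where
  "zero_min _ \<longleftrightarrow> (\<forall>a :: 'k. a \<le> 0 \<longrightarrow> a = 0)"

end

theory Submission
  imports Defs
begin

text \<open>
  Soundness of the selection rule holds because the weight of a shorter tuple is the sum of the
  weights of all longer tuples extending it. For completeness, let every weight be the idempotent
  \<open>k\<close>; then a weight is \<open>k\<close> or \<open>0\<close> according to whether a matching assignment exists, so weighted
  inclusion becomes ordinary inclusion. Use the variables themselves as values, with one extra blank
  value. To refute \<open>xs \<le> ys\<close>, take for every derivable \<open>us \<le> vs\<close> with \<open>us\<close> drawn from \<open>xs\<close> the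
  assignment that sends \<open>vs\<close> to \<open>us\<close> and every other variable to the blank. This team satisfies
  \<open>\<Sigma>\<close>, and it can satisfy \<open>xs \<le> ys\<close> only if that atom is itself derivable.
\<close>

section \<open>Derivations\<close>

text \<open>Forgets the conclusion and admits the empty sequence, so that derivations can be
  concatenated freely.\<close>

definition derivation ::
    "('v inc set \<Rightarrow> 'v inc set \<Rightarrow> bool) \<Rightarrow> 'v inc set \<Rightarrow> 'v inc list \<Rightarrow> bool" where
  "derivation \<A> \<Sigma> \<tau>s \<longleftrightarrow> (\<forall>i<length \<tau>s. \<tau>s ! i \<in> \<Sigma> \<or>
     (\<exists>\<Lambda> \<Gamma>. \<A> \<Lambda> \<Gamma> \<and> \<tau>s ! i \<in> \<Gamma> \<and> \<Lambda> \<subseteq> \<Sigma> \<union> set (take i \<tau>s)))"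

lemma derivable_iff_derivation:
  "derivable \<A> \<Sigma> \<sigma> \<longleftrightarrow> (\<exists>\<tau>s. \<tau>s \<noteq> [] \<and> last \<tau>s = \<sigma> \<and> derivation \<A> \<Sigma> \<tau>s)"
  by (simp add: derivable_def derivation_def)

text \<open>Prefixing \<open>ss\<close> only enlarges the set of atoms preceding each entry of
  \<open>ts\<close>, so every justification survives.\<close>

lemma derivation_append:
  assumes "derivation \<A> \<Sigma> ss" "derivation \<A> \<Sigma> ts"
  shows "derivation \<A> \<Sigma> (ss @ ts)"
  unfolding derivation_def
proof (intro allI impI)
  fix i assume i: "i < length (ss @ ts)"
  show "(ss @ ts) ! i \<in> \<Sigma> \<or> (\<exists>\<Lambda> \<Gamma>. \<A> \<Lambda> \<Gamma> \<and> (ss @ ts) ! i \<in> \<Gamma> \<and>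
      \<Lambda> \<subseteq> \<Sigma> \<union> set (take i (ss @ ts)))"
  proof (cases "i < length ss")
    case True
    then show ?thesis
      using assms(1) unfolding derivation_def by (auto simp: nth_append)
  next
    case False
    then obtain j where j: "i = length ss + j" "j < length ts"
      using i by (metis add_less_cancel_left le_iff_add length_append not_less)
    have "ts ! j \<in> \<Sigma> \<or> (\<exists>\<Lambda> \<Gamma>. \<A> \<Lambda> \<Gamma> \<and> ts ! j \<in> \<Gamma> \<and> \<Lambda> \<subseteq> \<Sigma> \<union> set (take j ts))"
      using assms(2) j unfolding derivation_def by blast
    then show ?thesis
      using j by (auto simp: nth_append)
  qed
qed

lemma derivation_snoc:
  assumes "derivation \<A> \<Sigma> ts"
    and "\<sigma> \<in> \<Sigma> \<or> (\<exists>\<Lambda> \<Gamma>. \<A> \<Lambda> \<Gamma> \<and> \<sigma> \<in> \<Gamma> \<and> \<Lambda> \<subseteq> \<Sigma> \<union> set ts)"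
  shows "derivation \<A> \<Sigma> (ts @ [\<sigma>])"
  using assms by (auto simp: derivation_def nth_append less_Suc_eq)

lemma derivable_assumption: "\<sigma> \<in> \<Sigma> \<Longrightarrow> derivable \<A> \<Sigma> \<sigma>"
  unfolding derivable_iff_derivation by (rule exI[of _ "[\<sigma>]"]) (simp add: derivation_def)

text \<open>A rule may have several premises, each with its own derivation; concatenation puts all
  of them into one sequence.\<close>

lemma derivation_covering:
  assumes "finite \<Lambda>" "\<And>l. l \<in> \<Lambda> \<Longrightarrow> derivable \<A> \<Sigma> l"
  shows "\<exists>ts. derivation \<A> \<Sigma> ts \<and> \<Lambda> \<subseteq> set ts"
  using assms
proof (induction \<Lambda> rule: finite_induct)
  case empty
  show ?case by (rule exI[of _ "[]"]) (simp add: derivation_def)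
next
  case (insert l \<Lambda>)
  then obtain ts where ts: "derivation \<A> \<Sigma> ts" "\<Lambda> \<subseteq> set ts" by auto
  obtain ss where ss: "ss \<noteq> []" "last ss = l" "derivation \<A> \<Sigma> ss"
    using insert.prems[of l] unfolding derivable_iff_derivation by auto
  show ?case
    using derivation_append[OF ss(3) ts(1)] ss ts(2) last_in_set[of ss]
    by (intro exI[of _ "ss @ ts"]) auto
qed

lemma derivable_rule:
  assumes "\<A> \<Lambda> \<Gamma>" "finite \<Lambda>" "\<And>l. l \<in> \<Lambda> \<Longrightarrow> derivable \<A> \<Sigma> l" "\<sigma> \<in> \<Gamma>"
  shows "derivable \<A> \<Sigma> \<sigma>"
proof -
  obtain ts where ts: "derivation \<A> \<Sigma> ts" "\<Lambda> \<subseteq> set ts"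
    using derivation_covering[OF assms(2,3)] by blast
  have "derivation \<A> \<Sigma> (ts @ [\<sigma>])"
    by (rule derivation_snoc[OF ts(1)]) (use assms(1,4) ts(2) in blast)
  then show ?thesis
    unfolding derivable_iff_derivation by (intro exI[of _ "ts @ [\<sigma>]"]) simp
qed

text \<open>Strong induction on the position in the sequence: a premise outside
  \<open>\<Sigma>\<close> occurs at an earlier position.\<close>

lemma derivable_induct:
  assumes "derivable \<A> \<Sigma> \<sigma>"
    and base: "\<And>\<sigma>. \<sigma> \<in> \<Sigma> \<Longrightarrow> P \<sigma>"
    and step: "\<And>\<Lambda> \<Gamma> \<sigma>. \<A> \<Lambda> \<Gamma> \<Longrightarrow> \<sigma> \<in> \<Gamma> \<Longrightarrow> (\<And>l. l \<in> \<Lambda> \<Longrightarrow> P l) \<Longrightarrow> P \<sigma>"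
  shows "P \<sigma>"
proof -
  obtain ts where ts: "ts \<noteq> []" "last ts = \<sigma>" "derivation \<A> \<Sigma> ts"
    using assms(1) unfolding derivable_iff_derivation by blast
  have "P (ts ! i)" if "i < length ts" for i
    using that
  proof (induction i rule: less_induct)
    case (less i)
    consider "ts ! i \<in> \<Sigma>" | \<Lambda> \<Gamma> where "\<A> \<Lambda> \<Gamma>" "ts ! i \<in> \<Gamma>" "\<Lambda> \<subseteq> \<Sigma> \<union> set (take i ts)"
      using ts(3) less.prems unfolding derivation_def by blast
    then show ?case
    proof cases
      case 1
      then show ?thesis by (rule base)
    next
      case 2
      have "P l" if "l \<in> \<Lambda>" for l
      proof (cases "l \<in> \<Sigma>")
        case False
        then have "l \<in> set (take i ts)" using 2(3) that by blast
        then obtain j where "j < i" "j < length ts" "l = ts ! j"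
          by (auto simp: in_set_conv_nth)
        then show ?thesis using less.IH by blast
      qed (rule base)
      then show ?thesis using step[OF 2(1,2)] by blast
    qed
  qed
  then show ?thesis
    using ts(1,2) by (metis diff_less last_conv_nth length_greater_0_conv zero_less_one)
qed

section \<open>Derived rules for inclusion atoms\<close>

lemma derivable_refl:
  "distinct xs \<Longrightarrow> set xs \<subseteq> D \<Longrightarrow> derivable (A_IND D) \<Sigma> (Inc xs xs)"
  by (rule derivable_rule[where \<A> = "A_IND D", OF A_IND.IND1]) auto

lemma derivable_trans:
  assumes "atom_over D (Inc xs ys)" "atom_over D (Inc ys zs)"
    and "derivable (A_IND D) \<Sigma> (Inc xs ys)" "derivable (A_IND D) \<Sigma> (Inc ys zs)"
  shows "derivable (A_IND D) \<Sigma> (Inc xs zs)"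
  by (rule derivable_rule[where \<A> = "A_IND D", OF A_IND.IND2[OF assms(1,2)]]) (use assms(3,4) in auto)

text \<open>Views an atom as its set of position-wise pairs: picking a repetition-free list of these
  pairs is an application of \<open>IND3\<close>, which spares later proofs the index
  sequences.\<close>

lemma derivable_selection:
  assumes at: "atom_over D (Inc us vs)" and der: "derivable (A_IND D) \<Sigma> (Inc us vs)"
    and len: "length us' = length vs'" and dist: "distinct us'"
    and sub: "set (zip us' vs') \<subseteq> set (zip us vs)"
  shows "derivable (A_IND D) \<Sigma> (Inc us' vs')"
\<comment> \<open>\<open>IND3\<close> demands a nonempty selection; the empty atom comes from
  reflexivity instead.\<close>
proof (cases "us' = []")
  case True
  then show ?thesis using len by (auto intro: derivable_refl)
next
  case False
  have "\<exists>i. i < length us \<and> us ! i = us' ! j \<and> vs ! i = vs' ! j" if "j < length us'" for j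
  proof -
    have "(us' ! j, vs' ! j) \<in> set (zip us' vs')"
      using that len by (force simp: set_zip)
    then have "(us' ! j, vs' ! j) \<in> set (zip us vs)" using sub by blast
    then show ?thesis by (auto simp: set_zip)
  qed
  then obtain g where g: "\<And>j. j < length us' \<Longrightarrow>
      g j < length us \<and> us ! g j = us' ! j \<and> vs ! g j = vs' ! j" by metis
  define js where "js = map g [0..<length us']"
  have us': "map ((!) us) js = us'" and vs': "map ((!) vs) js = vs'"
    using g len by (auto simp: js_def intro: nth_equalityI)
  \<comment> \<open>A repeated index would repeat an entry of \<open>us'\<close>.\<close>
  have "distinct js" using dist us' distinct_map by metis
  moreover have "js \<noteq> []" "set js \<subseteq> {..<length us}" using False g by (auto simp: js_def)
  ultimately have "A_IND D {Inc us vs} {Inc us' vs'}"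
    using A_IND.IND3[OF at, of js] us' vs' by simp
  then show ?thesis by (rule derivable_rule) (use der in auto)
qed

section \<open>Soundness\<close>

text \<open>Groups the assignments by their values on all of \<open>xs\<close>. The index set
  depends on \<open>xs\<close> only through its length, so the two sides of an atom expand over the
  same set.\<close>

lemma weight_selection:
  assumes "team D A X" "set xs \<subseteq> D" "set js \<subseteq> {..<length xs}"
  shows "weight X W (map ((!) xs) js) as =
    (\<Sum>bs | set bs \<subseteq> A \<and> length bs = length xs \<and> map ((!) bs) js = as. weight X W xs bs)"
    (is "_ = (\<Sum>bs\<in>?T. _)")
proof -
  let ?S = "{s \<in> X. map s (map ((!) xs) js) = as}"
  have sel: "map ((!) (map s xs)) js = map s (map ((!) xs) js)" for s :: "'a \<Rightarrow> 'b"
    using assms(3) by auto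
  have finT: "finite ?T"
    by (rule finite_subset[OF _ finite_lists_length_eq[of A "length xs"]])
      (use assms(1) in \<open>auto simp: team_def\<close>)
  have img: "(\<lambda>s. map s xs) ` ?S \<subseteq> ?T"
  proof clarify
    fix s assume s: "s \<in> X" "as = map s (map ((!) xs) js)"
    have "set (map s xs) \<subseteq> A" using s(1) assms(1,2) by (auto simp: team_def)
    then show "set (map s xs) \<subseteq> A \<and> length (map s xs) = length xs \<and>
        map ((!) (map s xs)) js = map s (map ((!) xs) js)"
      using sel[of s] by simp
  qed
  have "weight X W (map ((!) xs) js) as = sum W ?S" by (simp add: weight_def)
  also have "\<dots> = (\<Sum>bs\<in>?T. sum W {s \<in> ?S. map s xs = bs})"
    by (rule sum.group[symmetric]) (use assms(1) finT img in \<open>auto simp: team_def\<close>)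
  also have "\<dots> = (\<Sum>bs\<in>?T. weight X W xs bs)"
    unfolding weight_def
  proof (intro sum.cong refl)
    fix bs assume "bs \<in> ?T"
    \<comment> \<open>Agreement with \<open>bs\<close> on \<open>xs\<close> already forces the value
      \<open>as\<close> on the selected positions.\<close>
    then show "{s \<in> ?S. map s xs = bs} = {s \<in> X. map s xs = bs}" using sel by auto
  qed
  finally show ?thesis .
qed

text \<open>For \<open>IND3\<close>, expand both weights by \<open>weight_selection\<close> and
  compare the sums term by term.\<close>

lemma A_IND_sound:
  fixes W :: "('v \<Rightarrow> 'a) \<Rightarrow> 'k::{ordered_comm_monoid_add,linorder}"
  assumes "A_IND D \<Lambda> \<Gamma>" "team D A X" "\<forall>l\<in>\<Lambda>. satisfies A X W l" "\<gamma> \<in> \<Gamma>"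
  shows "satisfies A X W \<gamma>"
  using assms(1)
proof cases
  case (IND1 xs)
  then show ?thesis using assms(4) by auto
next
  case (IND2 xs ys zs)
  then show ?thesis using assms(3,4) by (fastforce intro: order_trans)
next
  case (IND3 xs ys js)
  have "weight X W (map ((!) xs) js) as \<le> weight X W (map ((!) ys) js) as" for as
  proof -
    have "satisfies A X W (Inc xs ys)" using IND3 assms(3) by auto
    moreover have "set xs \<subseteq> D" "set ys \<subseteq> D" "length ys = length xs" using IND3 by auto
    ultimately show ?thesis
      using weight_selection[OF assms(2), of xs js W as]
        weight_selection[OF assms(2), of ys js W as] IND3(6)
      by (auto intro!: sum_mono)
  qed
  then show ?thesis using IND3 assms(4) by auto
qed

lemma derivable_imp_entails:
  assumes "derivable (A_IND D) \<Sigma> \<tau>"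
  shows "entails TYPE('k::{ordered_comm_monoid_add,linorder}) TYPE('a) D \<Sigma> \<tau>"
  unfolding entails_def
proof (intro allI impI, elim conjE)
  fix A :: "'a set" and X and W :: "('b \<Rightarrow> 'a) \<Rightarrow> 'k"
  assume "team D A X" "\<forall>\<sigma>\<in>\<Sigma>. satisfies A X W \<sigma>"
  then show "satisfies A X W \<tau>"
    by (intro derivable_induct[OF assms, of "satisfies A X W"]) (blast intro: A_IND_sound)+
qed

section \<open>Completeness\<close>

lemma sum_const_idempotent:
  fixes k :: "'k::comm_monoid_add"
  assumes "finite S" "k + k = k"
  shows "(\<Sum>s\<in>S. k) = (if S = {} then 0 else k)"
  using assms(1)
  by (induction S rule: finite_induct) (use assms(2) in auto)

text \<open>Every weight is \<open>0\<close> or \<open>k\<close>, and \<open>0\<close> lies strictly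
  below \<open>k\<close>, so comparing weights compares the existence of matching
  assignments.\<close>

lemma satisfies_const_idempotent_iff:
  fixes k :: "'k::{comm_monoid_add,linorder}"
  assumes k: "k \<noteq> 0" "k + k = k" and "zero_min TYPE('k)"
    and X: "team D A X" and xs: "set xs \<subseteq> D"
  shows "satisfies A X (\<lambda>_. k) (Inc xs ys) \<longleftrightarrow> (\<forall>s\<in>X. \<exists>t\<in>X. map t ys = map s xs)"
proof -
  have nle: "\<not> k \<le> 0" using assms(1,3) by (auto simp: zero_min_def)
  have le: "0 \<le> k" using nle by simp
  have fin: "finite {s \<in> X. P s}" for P using X by (simp add: team_def)
  have "weight X (\<lambda>_. k) xs as \<le> weight X (\<lambda>_. k) ys as \<longleftrightarrow>
      ((\<exists>s\<in>X. map s xs = as) \<longrightarrow> (\<exists>t\<in>X. map t ys = as))" for as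
    unfolding weight_def sum_const_idempotent[OF fin k(2)]
    using nle le by (auto split: if_splits)
  then have "satisfies A X (\<lambda>_. k) (Inc xs ys) \<longleftrightarrow>
      (\<forall>as. set as \<subseteq> A \<and> length as = length xs \<longrightarrow>
        (\<exists>s\<in>X. map s xs = as) \<longrightarrow> (\<exists>t\<in>X. map t ys = as))"
    by simp
  \<comment> \<open>Value tuples realized by the team meet the side conditions on \<open>as\<close>,
    so quantifying over \<open>as\<close> becomes quantifying over \<open>s\<close>.\<close>
  moreover have "set (map s xs) \<subseteq> A \<and> length (map s xs) = length xs" if "s \<in> X" for s
    using that X xs by (auto simp: team_def)
  ultimately show ?thesis by blast
qed

section \<open>The counterexample team\<close>

definition chase_assignment ::
    "'v set \<Rightarrow> ('v \<Rightarrow> 'a) \<Rightarrow> 'a \<Rightarrow> 'v list \<Rightarrow> 'v list \<Rightarrow> 'v \<Rightarrow> 'a" where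
  "chase_assignment D f z us vs =
     (\<lambda>v\<in>D. case map_of (zip vs us) v of None \<Rightarrow> z | Some u \<Rightarrow> f u)"

text \<open>Collecting all derivable atoms at once replaces an iterated chase. The empty atom
  contributes the assignment that is blank on all of \<open>D\<close>.\<close>

definition chase_team ::
    "'v set \<Rightarrow> 'v inc set \<Rightarrow> ('v \<Rightarrow> 'a) \<Rightarrow> 'a \<Rightarrow> 'v list \<Rightarrow> ('v \<Rightarrow> 'a) set" where
  "chase_team D \<Sigma> f z xs = {chase_assignment D f z us vs | us vs.
     atom_over D (Inc us vs) \<and> set us \<subseteq> set xs \<and> derivable (A_IND D) \<Sigma> (Inc us vs)}"

lemma chase_assignment_paired:
  assumes "length us = length vs" "distinct vs" "(u, v) \<in> set (zip us vs)" "v \<in> D"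
  shows "chase_assignment D f z us vs v = f u"
proof -
  have "(v, u) \<in> set (zip vs us)" using assms(3) by (auto simp: set_zip)
  then have "map_of (zip vs us) v = Some u" using assms(1,2) by simp
  then show ?thesis using assms(4) by (simp add: chase_assignment_def)
qed

lemma chase_assignment_blank:
  assumes "length us = length vs" "v \<notin> set vs" "v \<in> D"
  shows "chase_assignment D f z us vs v = z"
proof -
  have "map_of (zip vs us) v = None" using assms(1,2) by (simp add: map_of_zip_is_None)
  then show ?thesis using assms(3) by (simp add: chase_assignment_def)
qed

lemma team_chase_team:
  assumes "finite D"
  shows "team D (insert z (f ` D)) (chase_team D \<Sigma> f z xs)"
proof -
  have "chase_assignment D f z us vs \<in> D \<rightarrow>\<^sub>E insert z (f ` D)" if "set us \<subseteq> D" for us vs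
  proof (rule PiE_I)
    fix v assume "v \<in> D"
    then show "chase_assignment D f z us vs v \<in> insert z (f ` D)"
      using that
      by (cases "map_of (zip vs us) v")
        (auto simp: chase_assignment_def dest!: map_of_SomeD set_zip_rightD)
  qed (simp add: chase_assignment_def)
  then have sub: "chase_team D \<Sigma> f z xs \<subseteq> D \<rightarrow>\<^sub>E insert z (f ` D)"
    unfolding chase_team_def by fastforce
  moreover have "finite (D \<rightarrow>\<^sub>E insert z (f ` D))" using assms by (simp add: finite_PiE)
  ultimately show ?thesis using assms by (auto simp: team_def intro: finite_subset)
qed

text \<open>Restrict \<open>ps\<close> to the variables \<open>ps'\<close> in \<open>vs\<close>,
  with partners \<open>qs'\<close> and sources \<open>us'\<close>. Selections give
  \<open>us' \<le> ps'\<close> and \<open>ps' \<le> qs'\<close>; by transitivity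
  \<open>us' \<le> qs'\<close> supplies the required assignment.\<close>

lemma chase_team_closed:
  assumes inc: "Inc ps qs \<in> \<Sigma>" "atom_over D (Inc ps qs)"
    and s: "s \<in> chase_team D \<Sigma> f z xs"
  shows "\<exists>t\<in>chase_team D \<Sigma> f z xs. map t qs = map s ps"
proof -
  obtain us vs where uv: "atom_over D (Inc us vs)" "set us \<subseteq> set xs"
      "derivable (A_IND D) \<Sigma> (Inc us vs)" and s_eq: "s = chase_assignment D f z us vs"
    using s unfolding chase_team_def by blast
  define js where "js = filter (\<lambda>j. ps ! j \<in> set vs) [0..<length ps]"
  define ps' where "ps' = map ((!) ps) js"
  define qs' where "qs' = map ((!) qs) js"
  have "\<exists>u. (u, v) \<in> set (zip us vs)" if "v \<in> set vs" for v
    using that uv(1) by (auto simp: in_set_conv_nth set_zip)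
  \<comment> \<open>\<open>g\<close> recovers the source of a variable: \<open>s v = f (g v)\<close>
    on \<open>vs\<close>.\<close>
  then obtain g where g: "\<And>v. v \<in> set vs \<Longrightarrow> (g v, v) \<in> set (zip us vs)" by metis
  define us' where "us' = map g ps'"
  have js: "distinct js" "set js \<subseteq> {..<length ps}" "\<And>j. j \<in> set js \<Longrightarrow> ps ! j \<in> set vs"
    by (auto simp: js_def)
  have ps': "set ps' \<subseteq> set vs" using js(3) by (auto simp: ps'_def)
  have inj_nth: "inj_on ((!) ps) (set js)" "inj_on ((!) qs) (set js)"
    using js(2) inc(2) by (auto intro!: inj_on_nth)
  \<comment> \<open>Since \<open>us\<close> has no repetitions, a source determines its position and
    hence its target; this makes \<open>us'\<close> repetition-free.\<close>
  have inj_g: "inj_on g (set vs)"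
  proof (rule inj_onI)
    fix v w assume "v \<in> set vs" "w \<in> set vs" "g v = g w"
    then have "(g v, v) \<in> set (zip us vs)" "(g v, w) \<in> set (zip us vs)" using g by metis+
    then show "v = w" using uv(1) by (auto simp: set_zip nth_eq_iff_index_eq)
  qed
  have dist: "distinct ps'" "distinct qs'" "distinct us'"
    using js(1) inj_nth inj_on_subset[OF inj_g ps']
    by (auto simp: ps'_def qs'_def us'_def distinct_map intro: comp_inj_on)
  have sets: "set us' \<subseteq> set us" "set ps' \<subseteq> set ps" "set qs' \<subseteq> set qs"
    using g ps' js(2) inc(2)
    by (auto simp: us'_def ps'_def qs'_def dest: set_zip_leftD)
  have len: "length us' = length ps'" "length ps' = length qs'"
    by (auto simp: us'_def ps'_def qs'_def)
  have "set (zip us' ps') \<subseteq> set (zip us vs)"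
    using g ps' by (auto simp: us'_def zip_map1 zip_same_conv_map)
  then have d1: "derivable (A_IND D) \<Sigma> (Inc us' ps')"
    using derivable_selection[OF uv(1,3)] len dist by blast
  have "set (zip ps' qs') \<subseteq> set (zip ps qs)"
    using js(2) inc(2) by (force simp: ps'_def qs'_def set_zip)
  then have d2: "derivable (A_IND D) \<Sigma> (Inc ps' qs')"
    using derivable_selection[OF inc(2) derivable_assumption[OF inc(1)]] len dist by blast
  have at: "atom_over D (Inc us' ps')" "atom_over D (Inc ps' qs')"
    "atom_over D (Inc us' qs')"
    using len dist sets uv(1) inc(2) by auto
  have "derivable (A_IND D) \<Sigma> (Inc us' qs')" by (rule derivable_trans[OF at(1,2) d1 d2])
  then have mem: "chase_assignment D f z us' qs' \<in> chase_team D \<Sigma> f z xs"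
    using at(3) sets(1) uv(2) unfolding chase_team_def by blast
  have "chase_assignment D f z us' qs' (qs ! j) = s (ps ! j)" if j: "j < length ps" for j
  proof (cases "ps ! j \<in> set vs")
    case True
    then have "j \<in> set js" using j by (simp add: js_def)
    then obtain i where i: "i < length js" "js ! i = j" by (auto simp: in_set_conv_nth)
    have "(g (ps ! j), qs ! j) \<in> set (zip us' qs')"
      using i by (force simp: set_zip us'_def ps'_def qs'_def)
    moreover have "qs ! j \<in> D" "ps ! j \<in> D" using j inc(2) by (auto simp: subset_iff)
    ultimately show ?thesis
      using chase_assignment_paired[of us' qs' "g (ps ! j)" "qs ! j" D f z]
        chase_assignment_paired[of us vs "g (ps ! j)" "ps ! j" D f z] at(3) uv(1) g[OF True] s_eq
      by simp
  next
    case False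
    \<comment> \<open>Here \<open>s\<close> is blank at \<open>ps ! j\<close>. As \<open>qs\<close>
      has no repetitions, \<open>qs ! j\<close> could enter \<open>qs'\<close> only through position
      \<open>j\<close>, so the new assignment is blank there too.\<close>
    have "qs ! j \<notin> set qs'"
    proof
      assume "qs ! j \<in> set qs'"
      then obtain i where "i \<in> set js" "qs ! i = qs ! j" by (auto simp: qs'_def)
      then have "i = j" using js(2) j inc(2) by (auto simp: nth_eq_iff_index_eq)
      then show False using js(3) \<open>i \<in> set js\<close> False by blast
    qed
    moreover have "qs ! j \<in> D" "ps ! j \<in> D" using j inc(2) by (auto simp: subset_iff)
    ultimately show ?thesis
      using chase_assignment_blank[of us' qs' "qs ! j" D f z]
        chase_assignment_blank[of us vs "ps ! j" D f z] at(3) uv(1) False s_eq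
      by simp
  qed
  then have "map (chase_assignment D f z us' qs') qs = map s ps"
    using inc(2) by (intro nth_equalityI) auto
  then show ?thesis using mem by blast
qed

text \<open>The atom \<open>xs \<le> xs\<close> puts into the team an assignment reading
  \<open>f\<close> on \<open>xs\<close>. A match \<open>t\<close> carries these values on
  \<open>ys\<close>, so the atom behind \<open>t\<close> contains every pair of
  \<open>xs \<le> ys\<close>, which is then a selection of it.\<close>

lemma chase_team_reflects:
  assumes at: "atom_over D (Inc xs ys)" and f: "inj_on f D" "z \<notin> f ` D"
    and sat: "\<forall>s\<in>chase_team D \<Sigma> f z xs. \<exists>t\<in>chase_team D \<Sigma> f z xs. map t ys = map s xs"
  shows "derivable (A_IND D) \<Sigma> (Inc xs ys)"
proof -
  have "chase_assignment D f z xs xs \<in> chase_team D \<Sigma> f z xs"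
    using at derivable_refl[of xs D \<Sigma>] unfolding chase_team_def
    by (intro CollectI exI[of _ xs] conjI refl) auto
  moreover have "map (chase_assignment D f z xs xs) xs = map f xs"
    using at by (auto intro!: chase_assignment_paired simp: zip_same subset_iff)
  ultimately obtain t where t: "t \<in> chase_team D \<Sigma> f z xs" "map t ys = map f xs"
    using sat by metis
  obtain us vs where uv: "atom_over D (Inc us vs)" "derivable (A_IND D) \<Sigma> (Inc us vs)"
      and t_eq: "t = chase_assignment D f z us vs"
    using t(1) unfolding chase_team_def by blast
  have "(xs ! j, ys ! j) \<in> set (zip us vs)" if j: "j < length xs" for j
  proof -
    have D: "xs ! j \<in> D" "ys ! j \<in> D" using at j by (auto simp: subset_iff)
    have tj: "t (ys ! j) = f (xs ! j)" using t(2) j at by (metis atom_over.simps nth_map)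
    \<comment> \<open>Otherwise \<open>t\<close> would be blank at \<open>ys ! j\<close>, but
      \<open>z\<close> is not in the image of \<open>f\<close>.\<close>
    then have "ys ! j \<in> set vs"
      using chase_assignment_blank[of us vs "ys ! j" D f z] uv(1) f(2) D t_eq by force
    then obtain i where i: "i < length vs" "vs ! i = ys ! j" by (auto simp: in_set_conv_nth)
    then have mem: "(us ! i, ys ! j) \<in> set (zip us vs)" using uv(1) by (force simp: set_zip)
    then have "f (us ! i) = f (xs ! j)"
      using chase_assignment_paired[OF _ _ mem D(2), of f z] uv(1) t_eq tj by simp
    moreover have "us ! i \<in> D" using i uv(1) by (auto simp: subset_iff)
    ultimately show ?thesis using mem f(1) D by (metis inj_onD)
  qed
  then have "set (zip xs ys) \<subseteq> set (zip us vs)" by (auto simp: set_zip[of xs])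
  then show ?thesis using derivable_selection[OF uv] at by auto
qed

lemma entails_imp_derivable:
  fixes k :: "'k::{comm_monoid_add,linorder}"
  assumes "zero_min TYPE('k)" "k \<noteq> 0" "k + k = k" "finite D"
    and \<Sigma>: "\<forall>\<sigma>\<in>\<Sigma>. atom_over D \<sigma>" and \<tau>: "atom_over D \<tau>"
    and ent: "entails TYPE('k) TYPE('a::infinite) D \<Sigma> \<tau>"
  shows "derivable (A_IND D) \<Sigma> \<tau>"
proof -
  obtain xs ys where \<tau>_eq: "\<tau> = Inc xs ys" by (cases \<tau>)
  \<comment> \<open>Variables are encoded as values by an injection \<open>f\<close> of
    \<open>D\<close> into the infinite universe; a value \<open>z\<close> outside its image serves
    as the blank.\<close>
  obtain B :: "'a set" where "finite B" "card B = card D"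
    using infinite_arbitrarily_large[OF infinite_UNIV] by blast
  then obtain f where f: "bij_betw f D B" using assms(4) by (metis finite_same_card_bij)
  obtain z where z: "z \<notin> B" using ex_new_if_finite[OF infinite_UNIV \<open>finite B\<close>] by blast
  let ?X = "chase_team D \<Sigma> f z xs" and ?A = "insert z (f ` D)"
  have sat_iff: "satisfies ?A ?X (\<lambda>_. k) (Inc ps qs) \<longleftrightarrow> (\<forall>s\<in>?X. \<exists>t\<in>?X. map t qs = map s ps)"
    if "set ps \<subseteq> D" for ps qs
    using satisfies_const_idempotent_iff[OF assms(2,3,1) team_chase_team[OF assms(4)] that] .
  have "satisfies ?A ?X (\<lambda>_. k) \<sigma>" if "\<sigma> \<in> \<Sigma>" for \<sigma>
  proof -
    obtain ps qs where \<sigma>: "\<sigma> = Inc ps qs" by (cases \<sigma>)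
    then have at: "atom_over D (Inc ps qs)" using \<Sigma> that by blast
    then have "set ps \<subseteq> D" by simp
    moreover have "\<forall>s\<in>?X. \<exists>t\<in>?X. map t qs = map s ps"
      by (rule ballI, rule chase_team_closed[OF _ at]) (use that \<sigma> in auto)
    ultimately show ?thesis unfolding \<sigma> by (rule sat_iff[THEN iffD2])
  qed
  then have sat: "satisfies ?A ?X (\<lambda>_. k) (Inc xs ys)"
    using ent[unfolded entails_def \<tau>_eq, rule_format, of ?A ?X "\<lambda>_. k"]
      team_chase_team[OF assms(4), of z f \<Sigma> xs] by blast
  have "set xs \<subseteq> D" using \<tau> \<tau>_eq by simp
  then have "\<forall>s\<in>?X. \<exists>t\<in>?X. map t ys = map s xs"
    using sat by (rule sat_iff[THEN iffD1])
  then show ?thesis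
    using chase_team_reflects[of D xs ys f z \<Sigma>] \<tau> \<tau>_eq f z by (auto simp: bij_betw_def)
qed

theorem theorem6:
  fixes k :: "'k::{semiring_1,ordered_semiring,linorder}"
    and D :: "'v set" and \<Sigma> :: "'v inc set" and \<tau> :: "'v inc"
  assumes "positive_semiring TYPE('k)"
    and "zero_min TYPE('k)"
    and "k \<noteq> 0" and "k + k = k"
    and "finite D" and "finite \<Sigma>"
    and "\<forall>\<sigma>\<in>\<Sigma> \<union> {\<tau>}. atom_over D \<sigma>"
  shows "derivable (A_IND D) \<Sigma> \<tau> \<longleftrightarrow> entails TYPE('k) TYPE('a::infinite) D \<Sigma> \<tau>"
  using derivable_imp_entails[of D \<Sigma> \<tau>, where ?'k = 'k and ?'a = 'a]
    entails_imp_derivable[where ?'a = 'a, OF assms(2-5), of \<Sigma> \<tau>] assms(7)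
  by blast

end
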